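(* For $i=1,2$ let $U_i$ be a $(1,k_i)_q$-evasive subspace of $V_i=V(r_i,q^n)$. Then $U=U_1\oplus U_2$ is a $(1,\max\{k_1,k_2\})_q$-evasive subspace of $V=V_1\oplus V_2$.
   Context: $V(m,q^n)$ denotes an $m$-dimensional vector space over $\mathbb{F}_{q^n}$, viewed also as an $mn$-dimensional vector space over $\mathbb{F}_q$. For positive integers $h,k$, an $\mathbb{F}_q$-subspace $U$ of an $\mathbb{F}_{q^n}$-vector space $V$ is called $(h,k)_q$-evasive if $\langle U\rangle_{\mathbb{F}_{q^n}}$ has $\mathbb{F}_{q^n}$-dimension at least $h$ and every $h$-dimensional $\mathbb{F}_{q^n}$-subspace of $V$ meets $U$ in an $\mathbb{F}_q$-subspace of $\mathbb{F}_q$-dimension at most $k$. *)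

theory Defs
  imports "HOL-Analysis.Product_Vector" "HOL-Library.Cardinality"
begin

(* The extension of F_q by F_{q^n} is a unital ring homomorphism between two field types
   (necessarily injective). *)
definition field_embedding :: "('q::field \<Rightarrow> 'k::field) \<Rightarrow> bool" where
  "field_embedding e \<longleftrightarrow>
     e 1 = 1 \<and> (\<forall>x y. e (x + y) = e x + e y) \<and> (\<forall>x y. e (x * y) = e x * e y)"

definition restrict_scalars ::
    "('q::field \<Rightarrow> 'k::field) \<Rightarrow> ('k \<Rightarrow> 'v::ab_group_add \<Rightarrow> 'v) \<Rightarrow> ('q \<Rightarrow> 'v \<Rightarrow> 'v)" where
  "restrict_scalars e s = (\<lambda>c v. s (e c) v)"

lemma vector_space_restrict_scalars:
  assumes "field_embedding e" and "vector_space s"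
  shows "vector_space (restrict_scalars e s)"
  using assms unfolding field_embedding_def restrict_scalars_def vector_space_def by simp

(* V(m, F): finite dimensionality is part of the condition, since dim UNIV = m alone would
   admit infinite-dimensional spaces for m = 0. *)
definition vector_space_of_dim ::
    "nat \<Rightarrow> ('k::field \<Rightarrow> 'v::ab_group_add \<Rightarrow> 'v) \<Rightarrow> bool" where
  "vector_space_of_dim m s \<longleftrightarrow>
     (\<exists>B. finite_dimensional_vector_space s B \<and> card B = m)"

(* The small field, and with it q, enters through e; s is the scalar multiplication of the
   large field. Meant for finite-dimensional spaces, where dim is the true dimension. *)
definition evasive ::
    "('q::field \<Rightarrow> 'k::field) \<Rightarrow> ('k \<Rightarrow> 'v::ab_group_add \<Rightarrow> 'v) \<Rightarrow> nat \<Rightarrow> nat \<Rightarrow> 'v set \<Rightarrow> bool" where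
  "evasive e s h k U \<longleftrightarrow>
     0 < h \<and> 0 < k \<and>
     module.subspace (restrict_scalars e s) U \<and>
     h \<le> vector_space.dim s (module.span s U) \<and>
     (\<forall>W. module.subspace s W \<and> vector_space.dim s W = h \<longrightarrow>
        vector_space.dim (restrict_scalars e s) (W \<inter> U) \<le> k)"

end

theory Submission
  imports Defs
begin

text \<open>A line \<open>W\<close> of \<open>V1 \<times> V2\<close> is spanned by a vector with a nonzero component, and the projection
  onto that component maps \<open>W\<close> bijectively onto a line of \<open>Vi\<close>. It therefore embeds
  \<open>W \<inter> (U1 \<times> U2)\<close> over the small field into the intersection of that line with \<open>Ui\<close>.\<close>

text \<open>An injective linear map carries a basis of \<open>S\<close> to an independent set inside
  the span of a basis of \<open>T\<close>. Finiteness of \<open>T\<close> as a set makes the latter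
  basis finite, so that cardinalities can be compared and \<open>dim\<close> does not take the value
  0 of an infinite basis.\<close>

lemma (in vector_space_pair) dim_le_inj_on:
  assumes f: "Vector_Spaces.linear s1 s2 f" and S: "vs1.subspace S" and inj: "inj_on f S"
    and sub: "f ` S \<subseteq> T" and fin: "finite T"
  shows "vs1.dim S \<le> vs2.dim T"
proof -
  obtain B where B: "B \<subseteq> S" "vs1.independent B" "S \<subseteq> vs1.span B" "card B = vs1.dim S"
    by (rule vs1.basis_exists)
  obtain C where C: "C \<subseteq> T" "vs2.independent C" "T \<subseteq> vs2.span C" "card C = vs2.dim T"
    by (rule vs2.basis_exists)
  \<comment> \<open>Preserving independence of \<open>B\<close> requires injectivity on all of its
    span, not only on \<open>B\<close>.\<close>
  have "vs1.span B \<subseteq> S"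
    using B(1) S by (rule vs1.span_minimal)
  then have "vs2.independent (f ` B)"
    using linear_independent_injective_image[OF f B(2)] inj inj_on_subset by blast
  moreover have "f ` B \<subseteq> vs2.span C"
    using B(1) sub C(3) by blast
  moreover have "finite C"
    using C(1) fin by (rule finite_subset)
  ultimately have "card (f ` B) \<le> card C"
    using vs2.independent_span_bound by blast
  moreover have "card (f ` B) = card B"
    using inj B(1) by (meson card_image inj_on_subset)
  ultimately show ?thesis
    using B(4) C(4) by simp
qed

lemma (in vector_space) dim_eq_1E:
  assumes "subspace W" "dim W = 1"
  obtains w where "w \<noteq> 0" "W = span {w}"
proof -
  obtain B where B: "B \<subseteq> W" "independent B" "W \<subseteq> span B" "card B = dim W"
    by (rule basis_exists)
  then obtain w where w: "B = {w}"
    using assms(2) by (metis card_1_singletonE)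
  show thesis
  proof
    show "w \<noteq> 0"
      using B(2) w dependent_zero by blast
    show "W = span {w}"
      using B(1,3) w assms(1) span_minimal by blast
  qed
qed

lemma (in vector_space) dim_span_singleton:
  assumes "w \<noteq> 0"
  shows "dim (span {w}) = 1"
  using assms dim_eq_card_independent[of "{w}"] by simp

lemma linear_restrict_scalars:
  assumes "field_embedding e" "Vector_Spaces.linear s t f"
  shows "Vector_Spaces.linear (restrict_scalars e s) (restrict_scalars e t) f"
  using assms unfolding Vector_Spaces.linear_iff
  by (simp add: vector_space_restrict_scalars) (simp add: restrict_scalars_def)

lemma subspace_restrict_scalars:
  assumes "field_embedding e" "vector_space s" "module.subspace s W"
  shows "module.subspace (restrict_scalars e s) W"
proof -
  interpret vector_space s by fact
  interpret r: vector_space "restrict_scalars e s"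
    using assms(1,2) by (rule vector_space_restrict_scalars)
  show ?thesis
    using assms(3) unfolding subspace_def r.subspace_def by (simp add: restrict_scalars_def)
qed

text \<open>Scalars act componentwise on the product, so restriction commutes with it. This
  transfers the subspace property of \<open>U1 \<times> U2\<close> between the two readings of the
  small-field structure.\<close>

lemma restrict_scalars_prod:
  assumes "field_embedding e" "vector_space s1" "vector_space s2"
  shows "restrict_scalars e (module_prod.scale s1 s2) =
    module_prod.scale (restrict_scalars e s1) (restrict_scalars e s2)"
proof -
  interpret vector_space_prod s1 s2
    using assms(2,3) by (simp add: vector_space_prod_def vector_space_pair_def)
  interpret r: vector_space_prod "restrict_scalars e s1" "restrict_scalars e s2"
    using assms by (simp add: vector_space_prod_def vector_space_pair_def vector_space_restrict_scalars)
  show ?thesis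
    unfolding fun_eq_iff r.scale_def by (simp add: restrict_scalars_def scale_def)
qed

text \<open>Since \<open>f w\<close> is nonzero, \<open>f\<close> is injective on the line through
  \<open>w\<close> and maps it onto a line, to which the evasiveness of \<open>T\<close> applies. A
  general linear \<open>f\<close> covers both projections at once.\<close>

lemma dim_line_Int_le_evasive:
  fixes e :: "'q::field \<Rightarrow> 'k::{field,finite}"
  assumes e: "field_embedding e" and f: "Vector_Spaces.linear s t f"
    and T: "evasive e t 1 k T" and U: "module.subspace (restrict_scalars e s) U"
    and img: "f ` U \<subseteq> T" and w: "f w \<noteq> 0"
  shows "vector_space.dim (restrict_scalars e s) (module.span s {w} \<inter> U) \<le> k"
proof -
  interpret f: Vector_Spaces.linear s t f by fact
  interpret r: vector_space_pair "restrict_scalars e s" "restrict_scalars e t"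
    by (simp add: vector_space_pair_def vector_space_restrict_scalars e f.vs1.vector_space_axioms
        f.vs2.vector_space_axioms)
  have span_image: "f ` f.vs1.span {w} = f.vs2.span {f w}"
    using f.span_image[of "{w}"] by simp
  \<comment> \<open>Here \<open>x\<close> is a multiple \<open>s c w\<close>, and
    \<open>t c (f w) = 0\<close> forces \<open>c = 0\<close>.\<close>
  have "x = 0" if "x \<in> f.vs1.span {w}" "f x = 0" for x
    using that w by (auto simp: f.vs1.span_singleton f.scale)
  then have inj: "inj_on f (f.vs1.span {w})"
    by (simp add: f.inj_on_iff_eq_0)
  have "r.vs1.dim (f.vs1.span {w} \<inter> U) \<le> r.vs2.dim (f.vs2.span {f w} \<inter> T)"
  proof (rule r.dim_le_inj_on)
    show "Vector_Spaces.linear (restrict_scalars e s) (restrict_scalars e t) f"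
      using e f by (rule linear_restrict_scalars)
    show "r.vs1.subspace (f.vs1.span {w} \<inter> U)"
      using U subspace_restrict_scalars[OF e f.vs1.vector_space_axioms f.vs1.subspace_span]
      by (rule r.vs1.subspace_inter[rotated])
    show "inj_on f (f.vs1.span {w} \<inter> U)"
      using inj by (rule inj_on_subset) simp
    show "f ` (f.vs1.span {w} \<inter> U) \<subseteq> f.vs2.span {f w} \<inter> T"
      using span_image img by blast
    \<comment> \<open>A line is the set of multiples of one vector by elements of the finite field
      \<open>'k\<close>.\<close>
    show "finite (f.vs2.span {f w} \<inter> T)"
      by (simp add: f.vs2.span_singleton)
  qed
  also have "\<dots> \<le> k"
    using T f.vs2.subspace_span f.vs2.dim_span_singleton[OF w] unfolding evasive_def by blast
  finally show ?thesis .
qed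

theorem theorem2p11:
  fixes e :: "'q::{field,finite} \<Rightarrow> 'k::{field,finite}"
    and s1 :: "'k \<Rightarrow> 'v1::ab_group_add \<Rightarrow> 'v1"
    and s2 :: "'k \<Rightarrow> 'v2::ab_group_add \<Rightarrow> 'v2"
    and q n r1 r2 k1 k2 :: nat
    and U1 :: "'v1 set" and U2 :: "'v2 set"
  assumes "CARD('q) = q" and "CARD('k) = q ^ n" and "field_embedding e"
    and "vector_space_of_dim r1 s1" and "vector_space_of_dim r2 s2"
    and "evasive e s1 1 k1 U1" and "evasive e s2 1 k2 U2"
  shows "evasive e (module_prod.scale s1 s2) 1 (max k1 k2) (U1 \<times> U2)"
proof -
  obtain B1 B2 where "finite_dimensional_vector_space s1 B1" "finite_dimensional_vector_space s2 B2"
    using assms(4,5) unfolding vector_space_of_dim_def by blast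
  then interpret finite_dimensional_vector_space_prod s1 s2 B1 B2
    by (intro finite_dimensional_vector_space_prod.intro vector_space_prod.intro
        vector_space_pair.intro finite_dimensional_vector_space_pair.intro
        finite_dimensional_vector_space_pair_1.intro finite_dimensional_vector_space.axioms(1))
  note vs = vs1.vector_space_axioms vs2.vector_space_axioms
  interpret r: vector_space_prod "restrict_scalars e s1" "restrict_scalars e s2"
    using assms(3) vs
    by (simp add: vector_space_prod_def vector_space_pair_def vector_space_restrict_scalars)
  have sub: "r.vs1.subspace U1" "r.vs2.subspace U2"
    using assms(6,7) unfolding evasive_def by blast+
  have subU: "module.subspace (restrict_scalars e scale) (U1 \<times> U2)"
    using r.subspace_Times[OF sub] restrict_scalars_prod[OF assms(3) vs] by simp
  have "1 \<le> vs1.dim (vs1.span U1)"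
    using assms(6) unfolding evasive_def by blast
  \<comment> \<open>In finite dimension, \<open>dim\<close> vanishes only on subsets of
    \<open>{0}\<close>; an infinite basis would also give 0.\<close>
  then have "\<not> U1 \<subseteq> {0}"
    using vs1.dim_eq_0[of U1] unfolding vs1.dim_span by linarith
  then obtain u where "u \<in> U1" "u \<noteq> 0"
    by blast
  \<comment> \<open>The witness is \<open>(u, 0)\<close>.\<close>
  then have "\<not> U1 \<times> U2 \<subseteq> {0}"
    using r.vs2.subspace_0[OF sub(2)] by (auto simp: zero_prod_def)
  then have dimU: "1 \<le> p.dim (p.span (U1 \<times> U2))"
    using p.dim_eq_0[of "U1 \<times> U2"] unfolding p.dim_span by linarith
  have "vector_space.dim (restrict_scalars e scale) (W \<inter> (U1 \<times> U2)) \<le> max k1 k2"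
    if W: "p.subspace W" "p.dim W = 1" for W
  proof -
    obtain w where w: "w \<noteq> 0" "W = p.span {w}"
      using W by (rule p.dim_eq_1E)
    \<comment> \<open>The nonzero component decides whether \<open>k1\<close> or \<open>k2\<close>
      bounds the intersection; the maximum covers both.\<close>
    then consider "fst w \<noteq> 0" | "snd w \<noteq> 0"
      by (auto simp: prod_eq_iff)
    then show ?thesis
    proof cases
      case 1
      then show ?thesis
        using dim_line_Int_le_evasive[OF assms(3) linear_fst assms(6) subU] w(2) by fastforce
    next
      case 2
      then show ?thesis
        using dim_line_Int_le_evasive[OF assms(3) linear_snd assms(7) subU] w(2) by fastforce
    qed
  qed
  moreover have "0 < max k1 k2"
    using assms(6) unfolding evasive_def by (simp add: less_max_iff_disj)
  ultimately show ?thesis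
    using subU dimU unfolding evasive_def by simp
qed

end
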